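(* Let $q\ge 2$ and $d\ge 2$ be integers and put $\kappa=(q^d-1)/(q-1)$. Suppose there is a symmetric $2$-$(m,\kappa,\lambda)$ design whose $(m\times m)$ incidence matrix $A$ is symmetric. Let $L=(e(i,j))$ be a symmetric $(m\times m)$ integer matrix obtained from $A$ by replacing, in each row, the $\kappa$ nonzero entries by the integers $1,2,\dots,\kappa$ bijectively (so $e(i,j)=0$ iff $A_{ij}=0$, and for each $i$ the map $j\mapsto e(i,j)$ is a bijection from $\{j: A_{ij}\neq 0\}$ onto $[\kappa]$). Let $\mathcal{D}_1,\dots,\mathcal{D}_m$ be (not necessarily isomorphic) affine designs with parameters $(q,q^{d-2})$, $\mathcal{D}_i=(\mathcal{P}_i,\mathcal{B}_i)$, with pairwise disjoint point sets, each having $\kappa$ parallel classes, enumerated by $[\kappa]$; denote the $j$-th parallel class of $\mathcal{D}_i$ by $\mathcal{B}_i^j$, and for $x\in\mathcal{P}_i$ denote by $B_i^j(x)$ the block of $\mathcal{B}_i^j$ containing $x$. For each pair $(i,j)$ with $e(i,j)\neq 0$ choose a bijection $\sigma_{i,j}:\mathcal{B}_i^{e(i,j)}\to\mathcal{B}_j^{e(j,i)}$ with $\sigma_{i,j}=\sigma_{j,i}^{-1}$ for $i\ne j$ and $\sigma_{i,i}$ the identity on $\mathcal{B}_i^{e(i,i)}$. Let $\Gamma$ be the graph with vertex set $\bigcup_{i=1}^m\mathcal{P}_i$ in which two different vertices $x\in\mathcal{P}_i$, $y\in\mathcal{P}_j$ are adjacent iff $e(i,j)\neq 0$ and $y\notin\sigma_{i,j}(B_i^{e(i,j)}(x))$.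 Let $M$ be the adjacency matrix of $\Gamma$, partitioned into $(q^d\times q^d)$ blocks $M_{ij}$ (rows indexed by $\mathcal{P}_i$, columns by $\mathcal{P}_j$). Assume all diagonal blocks $M_{ii}$ are nonzero matrices. Let $PC(M)$ be the matrix obtained from $M$ by replacing every zero off-diagonal block $M_{ij}$ ($i\neq j$) by the all-ones matrix of the same size, and let $PC(\Gamma)$ be the graph with adjacency matrix $PC(M)$. Then $PC(\Gamma)$ is a divisible design graph with parameters $$v=q^d m,\quad k=q^{d-1}(q^d-1)+q^d(m-\kappa),\quad \lambda_1=q^{d-1}(q^d-q^{d-1}-1)+q^d(m-\kappa),$$ $$\lambda_2=q^{d-2}(q-1)^2\lambda+2(q^d-q^{d-1})(\kappa-\lambda)+q^d(m-2\kappa+\lambda),\quad m,\quad n=q^d.$$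
   Context: A $k$-regular graph on $v$ vertices is a divisible design graph with parameters $(v,k,\lambda_1,\lambda_2,m,n)$ if its vertex set can be partitioned into $m$ classes of size $n$ such that any two different vertices in the same class have exactly $\lambda_1$ common neighbours and any two vertices in different classes have exactly $\lambda_2$ common neighbours. A symmetric $2$-$(m,\kappa,\lambda)$ design has $m$ points and $m$ blocks, each block of size $\kappa$, any two distinct points lying in exactly $\lambda$ common blocks. An affine design with parameters $(q,r)$ is a $2$-design in which any two blocks are either disjoint or meet in exactly $r$ points, and each block together with all blocks disjoint from it forms a parallel class: a set of $q$ mutually disjoint blocks partitioning the point set. An affine design with parameters $(q,q^{d-2})$ has $q^d$ points, blocks of size $q^{d-1}$, $(q^d-1)/(q-1)$ parallel classes, and any two distinct points lie in exactly $(q^{d-1}-1)/(q-1)$ common blocks. *)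

theory Defs
  imports "Graph_Theory.Graph_Theory" "HOL-Library.Disjoint_Sets"
begin

text \<open>
  An incidence structure consists of points \<open>X\<close>, blocks \<open>Y\<close> and an incidence relation
  \<open>inc\<close>, so that distinct blocks may be incident with the same points.
\<close>

definition two_design ::
  "'p set \<Rightarrow> 'b set \<Rightarrow> ('p \<Rightarrow> 'b \<Rightarrow> bool) \<Rightarrow> nat \<Rightarrow> nat \<Rightarrow> nat \<Rightarrow> bool" where
  "two_design X Y inc v k l \<longleftrightarrow>
     finite X \<and> finite Y \<and> card X = v \<and>
     (\<forall>b\<in>Y. card {x \<in> X. inc x b} = k) \<and>
     (\<forall>x\<in>X. \<forall>y\<in>X. x \<noteq> y \<longrightarrow> card {b \<in> Y. inc x b \<and> inc y b} = l)"

definition symmetric_design ::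
  "'p set \<Rightarrow> 'b set \<Rightarrow> ('p \<Rightarrow> 'b \<Rightarrow> bool) \<Rightarrow> nat \<Rightarrow> nat \<Rightarrow> nat \<Rightarrow> bool" where
  "symmetric_design X Y inc v k l \<longleftrightarrow> two_design X Y inc v k l \<and> card Y = v"

text \<open>
  The incidence matrix depends on enumerations \<open>pt\<close> of the points (rows) and \<open>bl\<close> of the blocks
  (columns). Matrices of size \<open>m\<close> are functions used on the index range \<open>{1..m}\<close> only.
\<close>

definition is_incidence_matrix ::
  "'p set \<Rightarrow> 'b set \<Rightarrow> ('p \<Rightarrow> 'b \<Rightarrow> bool) \<Rightarrow> nat \<Rightarrow> (nat \<Rightarrow> nat \<Rightarrow> int) \<Rightarrow> bool" where
  "is_incidence_matrix X Y inc m A \<longleftrightarrow>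
     (\<exists>pt bl. bij_betw pt {1..m} X \<and> bij_betw bl {1..m} Y \<and>
        (\<forall>i\<in>{1..m}. \<forall>j\<in>{1..m}. A i j = (if inc (pt i) (bl j) then 1 else 0)))"

definition symmetric_matrix :: "nat \<Rightarrow> (nat \<Rightarrow> nat \<Rightarrow> 'c) \<Rightarrow> bool" where
  "symmetric_matrix m A \<longleftrightarrow> (\<forall>i\<in>{1..m}. \<forall>j\<in>{1..m}. A i j = A j i)"

definition parallel_class :: "'a set set \<Rightarrow> 'a set \<Rightarrow> 'a set set" where
  "parallel_class B b = insert b {c \<in> B. b \<inter> c = {}}"

definition parallel_classes :: "'a set set \<Rightarrow> 'a set set set" where
  "parallel_classes B = parallel_class B ` B"

text \<open>
  Representing the blocks of an affine design by their point sets loses nothing: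
  the point set of a block lies in a partition of all points, and two blocks with the same points
  would be neither disjoint nor meet in \<open>r\<close> points (for \<open>q > 1\<close>, when a block has \<open>q * r\<close> points).
\<close>

definition affine_design :: "nat \<Rightarrow> nat \<Rightarrow> 'a set \<Rightarrow> 'a set set \<Rightarrow> bool" where
  "affine_design q r P B \<longleftrightarrow>
     (\<exists>v k l. two_design P B (\<in>) v k l) \<and>
     (\<forall>b\<in>B. b \<subseteq> P) \<and>
     (\<forall>b\<in>B. \<forall>c\<in>B. b \<noteq> c \<longrightarrow> b \<inter> c = {} \<or> card (b \<inter> c) = r) \<and>
     (\<forall>b\<in>B. card (parallel_class B b) = q \<and> partition_on P (parallel_class B b))"

definition block_through :: "'a set set \<Rightarrow> 'a \<Rightarrow> 'a set" where
  "block_through C x = (THE b. b \<in> C \<and> x \<in> b)"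

text \<open>
  Undirected simple graphs are the finite, symmetric, loop-free digraphs of the locale
  \<^locale>\<open>pair_graph\<close>.
\<close>

definition common_neighbours :: "'a pair_pre_digraph \<Rightarrow> 'a \<Rightarrow> 'a \<Rightarrow> 'a set" where
  "common_neighbours G x y = {z \<in> pverts G. (x, z) \<in> parcs G \<and> (y, z) \<in> parcs G}"

definition regular_graph :: "'a pair_pre_digraph \<Rightarrow> nat \<Rightarrow> bool" where
  "regular_graph G k \<longleftrightarrow> (\<forall>x\<in>pverts G. out_degree (with_proj G) x = k)"

definition divisible_design_graph ::
  "'a pair_pre_digraph \<Rightarrow> nat \<Rightarrow> nat \<Rightarrow> nat \<Rightarrow> nat \<Rightarrow> nat \<Rightarrow> nat \<Rightarrow> bool" where
  "divisible_design_graph G v k l1 l2 m n \<longleftrightarrow>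
     pair_graph G \<and> card (pverts G) = v \<and> regular_graph G k \<and>
     (\<exists>\<C>. partition_on (pverts G) \<C> \<and> card \<C> = m \<and> (\<forall>c\<in>\<C>. card c = n) \<and>
        (\<forall>c\<in>\<C>. \<forall>x\<in>c. \<forall>y\<in>c. x \<noteq> y \<longrightarrow> card (common_neighbours G x y) = l1) \<and>
        (\<forall>c\<in>\<C>. \<forall>c'\<in>\<C>. c \<noteq> c' \<longrightarrow>
           (\<forall>x\<in>c. \<forall>y\<in>c'. card (common_neighbours G x y) = l2)))"

definition adjacency_matrix :: "'a pair_pre_digraph \<Rightarrow> 'a \<Rightarrow> 'a \<Rightarrow> int" where
  "adjacency_matrix G x y = (if (x, y) \<in> parcs G then 1 else 0)"

definition graph_of_matrix :: "'a set \<Rightarrow> ('a \<Rightarrow> 'a \<Rightarrow> int) \<Rightarrow> 'a pair_pre_digraph" where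
  "graph_of_matrix V N = \<lparr> pverts = V, parcs = {(x, y). x \<in> V \<and> y \<in> V \<and> N x y = 1} \<rparr>"

definition zero_block :: "('a \<Rightarrow> 'a \<Rightarrow> int) \<Rightarrow> 'a set \<Rightarrow> 'a set \<Rightarrow> bool" where
  "zero_block N R S \<longleftrightarrow> (\<forall>x\<in>R. \<forall>y\<in>S. N x y = 0)"

definition PC_matrix ::
  "nat \<Rightarrow> (nat \<Rightarrow> 'a set) \<Rightarrow> ('a \<Rightarrow> 'a \<Rightarrow> int) \<Rightarrow> 'a \<Rightarrow> 'a \<Rightarrow> int" where
  "PC_matrix m P N x y =
     (if \<exists>i\<in>{1..m}. \<exists>j\<in>{1..m}. i \<noteq> j \<and> x \<in> P i \<and> y \<in> P j \<and> zero_block N (P i) (P j)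
      then 1 else N x y)"

definition PC_graph :: "nat \<Rightarrow> (nat \<Rightarrow> 'a set) \<Rightarrow> 'a pair_pre_digraph \<Rightarrow> 'a pair_pre_digraph" where
  "PC_graph m P G = graph_of_matrix (pverts G) (PC_matrix m P (adjacency_matrix G))"

text \<open>
  \<open>P i\<close> is the point set of the \<open>i\<close>-th affine design, \<open>C i j\<close> its \<open>j\<close>-th parallel class.
\<close>

definition design_graph ::
  "nat \<Rightarrow> (nat \<Rightarrow> nat \<Rightarrow> nat) \<Rightarrow> (nat \<Rightarrow> 'a set) \<Rightarrow> (nat \<Rightarrow> nat \<Rightarrow> 'a set set) \<Rightarrow>
   (nat \<Rightarrow> nat \<Rightarrow> 'a set \<Rightarrow> 'a set) \<Rightarrow> 'a pair_pre_digraph" where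
  "design_graph m e P C \<sigma> =
     \<lparr> pverts = (\<Union>i\<in>{1..m}. P i),
       parcs = {(x, y). x \<noteq> y \<and>
         (\<exists>i\<in>{1..m}. \<exists>j\<in>{1..m}. x \<in> P i \<and> y \<in> P j \<and> e i j \<noteq> 0 \<and>
            y \<notin> \<sigma> i j (block_through (C i (e i j)) x))} \<rparr>"

end

theory Submission
  imports Defs
begin

text \<open>
  In \<open>PC(\<Gamma>)\<close> the non-neighbours of \<open>x \<in> P i\<close> inside \<open>P j\<close> form the empty set if \<open>e i j = 0\<close> and
  a single block of \<open>D j\<close> otherwise (the nonzero diagonal blocks force \<open>e i i \<noteq> 0\<close>).
  By inclusion-exclusion in each \<open>P j\<close>, two vertices have
  \<open>m q^d - 2 \<kappa> q^(d-1)\<close> common neighbours, plus the sum over \<open>j\<close> of the sizes of the intersections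
  of their two missed blocks.
  For two points of one class the missed blocks are equal or disjoint, and they are equal for
  precisely \<open>\<kappa> - q^(d-1)\<close> indices \<open>j\<close>, the number of blocks of \<open>D i\<close> through both points.
  For points of different classes they are both nonempty for \<open>\<lambda>\<close> indices; since \<open>e j\<close> is injective they
  then lie in different parallel classes and meet in \<open>q^(d-2)\<close> points.
\<close>

section \<open>Auxiliary facts on restricted bijections and indexed disjoint families\<close>

lemma bij_betw_Collect_comp:
  assumes "bij_betw f S T"
  shows "bij_betw f {a \<in> S. Q (f a)} {b \<in> T. Q b}"
  using bij_betw_subset[OF assms, of "{a \<in> S. Q (f a)}"] bij_betw_imp_surj_on[OF assms]
  by (auto simp: bij_betw_def)

text \<open>In a disjoint family a point determines its index. This collapses the existential index
  quantifiers in \<open>design_graph\<close> and \<open>PC_matrix\<close>.\<close>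

lemma bex_disjoint_family_iff:
  assumes "disjoint_family_on P I" "i \<in> I" "j \<in> I" "x \<in> P i" "y \<in> P j"
  shows "(\<exists>i'\<in>I. \<exists>j'\<in>I. x \<in> P i' \<and> y \<in> P j' \<and> Q i' j') \<longleftrightarrow> Q i j"
proof -
  have "i' = i" if "i' \<in> I" "x \<in> P i'" for i'
    using assms(1,2,4) that unfolding disjoint_family_on_def by blast
  moreover have "j' = j" if "j' \<in> I" "y \<in> P j'" for j'
    using assms(1,3,5) that unfolding disjoint_family_on_def by blast
  ultimately show ?thesis using assms(2-5) by blast
qed

section \<open>Affine designs\<close>

lemma block_through_props:
  assumes "partition_on P D" and "x \<in> P"
  shows block_through_mem: "block_through D x \<in> D"
    and mem_block_through: "x \<in> block_through D x"
proof -
  obtain b where b: "b \<in> D" "x \<in> b"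
    using assms by (auto simp: partition_on_def)
  have "\<And>c. c \<in> D \<and> x \<in> c \<Longrightarrow> c = b"
    using assms(1) b by (auto simp: partition_on_def dest: disjointD)
  with b have "block_through D x \<in> D \<and> x \<in> block_through D x"
    unfolding block_through_def by (rule theI[of "\<lambda>c. c \<in> D \<and> x \<in> c" b, OF conjI])
  then show "block_through D x \<in> D" "x \<in> block_through D x" by auto
qed

lemma block_through_eq:
  assumes "partition_on P D" and "b \<in> D" and "x \<in> b"
  shows "block_through D x = b"
proof -
  have "x \<in> P" using assms by (auto simp: partition_on_def)
  note block_through_mem[OF assms(1) this] mem_block_through[OF assms(1) this]
  with assms show ?thesis unfolding partition_on_def disjoint_def by blast
qed

text \<open>Any other member of the partition \<open>parallel_class B b\<close> is disjoint from
  \<open>c\<close>, so this class is contained in that of \<open>c\<close>; both have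
  \<open>q\<close> elements. Parallelism is thus an equivalence relation.\<close>

lemma parallel_class_eq:
  assumes "affine_design q r P B" and "b \<in> B" and "c \<in> parallel_class B b"
  shows "parallel_class B c = parallel_class B b"
proof -
  have part: "partition_on P (parallel_class B b)"
    and card: "\<And>a. a \<in> B \<Longrightarrow> card (parallel_class B a) = q"
    and fin: "finite B"
    using assms by (auto simp: affine_design_def two_design_def)
  have sub: "\<And>a. a \<in> B \<Longrightarrow> parallel_class B a \<subseteq> B" by (auto simp: parallel_class_def)
  have c: "c \<in> B" using sub assms by blast
  have "parallel_class B b \<subseteq> parallel_class B c"
  proof
    fix a assume a: "a \<in> parallel_class B b"
    show "a \<in> parallel_class B c"
    proof (cases "a = c")
      case False
      then have "c \<inter> a = {}"
        using part a assms(3) by (auto simp: partition_on_def dest: disjointD)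
      with a sub[OF assms(2)] show ?thesis by (auto simp: parallel_class_def)
    qed (simp add: parallel_class_def)
  qed
  moreover have "finite (parallel_class B c)" using sub[OF c] fin finite_subset by blast
  ultimately show ?thesis using card[OF assms(2)] card[OF c] by (metis card_subset_eq)
qed

lemma parallel_class_of_mem:
  assumes "affine_design q r P B" and "D \<in> parallel_classes B" and "b \<in> D"
  shows "b \<in> B" and "parallel_class B b = D"
proof -
  obtain a where a: "a \<in> B" "D = parallel_class B a"
    using assms by (auto simp: parallel_classes_def)
  then show "b \<in> B" using assms(3) by (auto simp: parallel_class_def)
  show "parallel_class B b = D" using parallel_class_eq[OF assms(1) a(1)] a(2) assms(3) by blast
qed

lemma parallel_classes_partition:
  assumes "affine_design q r P B" and "D \<in> parallel_classes B"
  shows "partition_on P D" and "card D = q"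
  using assms by (auto simp: affine_design_def parallel_classes_def)

text \<open>If \<open>b\<close> and \<open>c\<close> were equal or disjoint, \<open>c\<close> would
  lie in the parallel class of \<open>b\<close>, forcing \<open>D = E\<close>.\<close>

lemma card_Int_nonparallel:
  assumes "affine_design q r P B" and "D \<in> parallel_classes B" and "E \<in> parallel_classes B"
    and "D \<noteq> E" and "b \<in> D" and "c \<in> E"
  shows "card (b \<inter> c) = r"
proof -
  have "c \<notin> parallel_class B b"
    using parallel_class_of_mem(2)[OF assms(1)] assms(2-) by metis
  moreover have "b \<in> B" "c \<in> B" using parallel_class_of_mem(1)[OF assms(1)] assms(2-) by auto
  ultimately have "b \<noteq> c" "b \<inter> c \<noteq> {}" "b \<in> B" "c \<in> B"
    by (auto simp: parallel_class_def)
  then show ?thesis using assms(1) unfolding affine_design_def by blast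
qed

text \<open>The \<open>q\<close> blocks of a second class \<open>D\<close> cut \<open>c\<close> into
  pieces of size \<open>r\<close>.\<close>

lemma card_block:
  assumes aff: "affine_design q r P B" and "D \<in> parallel_classes B" and "E \<in> parallel_classes B"
    and "D \<noteq> E" and "c \<in> E"
  shows "card c = q * r"
proof -
  note D = parallel_classes_partition[OF aff assms(2)]
  have finP: "finite P" using aff by (auto simp: affine_design_def two_design_def)
  have cP: "c \<subseteq> P"
    using parallel_classes_partition(1)[OF aff assms(3)] assms(5) by (auto simp: partition_on_def)
  have finD: "finite D" using D(1) finP by (rule finite_elements[rotated])
  have "c = (\<Union>b\<in>D. b \<inter> c)" using D(1) cP by (auto simp: partition_on_def)
  then have "card c = card (\<Union>b\<in>D. b \<inter> c)" by simp
  also have "\<dots> = (\<Sum>b\<in>D. card (b \<inter> c))"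
    using finD finite_subset[OF cP finP] D(1)
    by (intro card_UN_disjoint) (auto simp: partition_on_def dest: disjointD)
  also have "\<dots> = (\<Sum>b\<in>D. r)"
    using card_Int_nonparallel[OF assms(1-4) _ assms(5)] by simp
  finally show ?thesis using D(2) by simp
qed

lemma card_points:
  assumes aff: "affine_design q r P B" and "D \<in> parallel_classes B" and "E \<in> parallel_classes B"
    and "D \<noteq> E"
  shows "card P = q * (q * r)"
proof -
  note E = parallel_classes_partition[OF aff assms(3)]
  have finP: "finite P" using aff by (auto simp: affine_design_def two_design_def)
  have fin: "finite c" if "c \<in> E" for c
    using that E(1) finP by (auto simp: partition_on_def intro: finite_subset)
  have "card P = card (\<Union>E)" using E(1) by (simp add: partition_on_def)
  also have "\<dots> = (\<Sum>c\<in>E. card c)"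
    using E(1) fin
    by (intro card_Union_disjoint) (auto simp: partition_on_def)
  also have "\<dots> = (\<Sum>c\<in>E. q * r)" using card_block[OF assms] by simp
  finally show ?thesis using E(2) by simp
qed

lemma finite_parallel_classes:
  "affine_design q r P B \<Longrightarrow> finite (parallel_classes B)"
  by (auto simp: affine_design_def two_design_def parallel_classes_def)

text \<open>Double counting, for fixed \<open>x\<close>, of the pairs of a point \<open>z\<close>
  other than \<open>x\<close> and a parallel class whose block through \<open>x\<close> contains
  \<open>z\<close>. By the design property every \<open>z\<close> occurs equally often. The result
  is kept free of division.\<close>

lemma card_classes_joining:
  assumes aff: "affine_design q r P B" and "D \<in> parallel_classes B" and "E \<in> parallel_classes B"
    and "D \<noteq> E" and x: "x \<in> P" and y: "y \<in> P" "x \<noteq> y"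
  shows "(q * (q * r) - 1) * card {F \<in> parallel_classes B. block_through F x = block_through F y}
           = card (parallel_classes B) * (q * r - 1)"
proof -
  let ?K = "parallel_classes B"
  have finP: "finite P" using aff by (auto simp: affine_design_def two_design_def)
  have finK: "finite ?K" using aff by (rule finite_parallel_classes)
  obtain L where L: "\<And>x y. x \<in> P \<Longrightarrow> y \<in> P \<Longrightarrow> x \<noteq> y \<Longrightarrow> card {b \<in> B. x \<in> b \<and> y \<in> b} = L"
    using aff by (auto simp: affine_design_def two_design_def)
  note part = parallel_classes_partition(1)[OF aff]
  have joining: "card {F \<in> ?K. block_through F x = block_through F z} = L"
    if z: "z \<in> P" "x \<noteq> z" for z
  proof -
    \<comment> \<open>A class joining \<open>x\<close> and \<open>z\<close> corresponds to its block
      through both; the inverse sends a block to its parallel class.\<close>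
    have "bij_betw (\<lambda>F. block_through F x) {F \<in> ?K. block_through F x = block_through F z}
            {b \<in> B. x \<in> b \<and> z \<in> b}"
    proof (rule bij_betw_byWitness[where f' = "parallel_class B"])
      show "\<forall>F\<in>{F \<in> ?K. block_through F x = block_through F z}.
              parallel_class B (block_through F x) = F"
        using block_through_mem[OF part x] parallel_class_of_mem(2)[OF aff] by blast
      have "block_through (parallel_class B b) u = b" if "b \<in> B" "u \<in> b" for b u
        using that by (intro block_through_eq[OF part])
          (auto simp: parallel_classes_def parallel_class_def)
      then show "\<forall>b\<in>{b \<in> B. x \<in> b \<and> z \<in> b}. block_through (parallel_class B b) x = b"
        and "parallel_class B ` {b \<in> B. x \<in> b \<and> z \<in> b}
               \<subseteq> {F \<in> ?K. block_through F x = block_through F z}"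
        by (auto simp: parallel_classes_def)
      show "(\<lambda>F. block_through F x) ` {F \<in> ?K. block_through F x = block_through F z}
              \<subseteq> {b \<in> B. x \<in> b \<and> z \<in> b}"
        using block_through_mem[OF part z(1)] mem_block_through[OF part x]
          mem_block_through[OF part z(1)] by (auto intro: parallel_class_of_mem(1)[OF aff])
    qed
    from bij_betw_same_card[OF this] show ?thesis using L[OF x z] by simp
  qed
  have "card {z \<in> P - {x}. block_through F x = block_through F z} = q * r - 1"
    if F: "F \<in> ?K" for F
  proof -
    let ?b = "block_through F x"
    have b: "?b \<in> F" "x \<in> ?b" "?b \<subseteq> P"
      using block_through_mem[OF part[OF F] x] mem_block_through[OF part[OF F] x] part[OF F]
      by (auto simp: partition_on_def)
    have "?b = block_through F z \<longleftrightarrow> z \<in> ?b" if "z \<in> P" for z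
      using mem_block_through[OF part[OF F] that] block_through_eq[OF part[OF F] b(1), of z] by metis
    then have "{z \<in> P - {x}. ?b = block_through F z} = ?b - {x}" using b(3) by blast
    \<comment> \<open>\<open>card_block\<close> requires a class different from \<open>F\<close>; at
      least one of \<open>D\<close> and \<open>E\<close> is.\<close>
    moreover have "card ?b = q * r"
      using card_block[OF aff assms(2) F] card_block[OF aff assms(3) F] assms(4) b(1) by metis
    ultimately show ?thesis using b(2) finite_subset[OF b(3) finP] by simp
  qed
  then have "(\<Sum>z\<in>P - {x}. card {F \<in> ?K. block_through F x = block_through F z})
               = (\<Sum>F\<in>?K. q * r - 1)"
    using finP finK by (intro sum_multicount_gen) auto
  moreover have "card (P - {x}) = q * (q * r) - 1"
    using card_points[OF aff assms(2-4)] x finP by simp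
  moreover have "(\<Sum>z\<in>P - {x}. card {F \<in> ?K. block_through F x = block_through F z})
      = (\<Sum>z\<in>P - {x}. L)"
    using joining by (intro sum.cong) auto
  ultimately show ?thesis using joining[OF y] by simp
qed

section \<open>The partial complement of a design graph\<close>

text \<open>Here \<open>r\<close> stands for \<open>q ^ (d - 2)\<close>, so blocks have
  \<open>q * r\<close> points, designs have \<open>q * (q * r)\<close> points, and no exponents
  remain. The symmetric design enters only through the row supports of \<open>e\<close>: their size
  by \<open>e_bij\<close>, their intersections by \<open>e_common\<close>.\<close>

locale partial_complement =
  fixes q r \<kappa> l m :: nat and e :: "nat \<Rightarrow> nat \<Rightarrow> nat"
    and P :: "nat \<Rightarrow> 'a set" and B :: "nat \<Rightarrow> 'a set set" and C :: "nat \<Rightarrow> nat \<Rightarrow> 'a set set"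
    and \<sigma> :: "nat \<Rightarrow> nat \<Rightarrow> 'a set \<Rightarrow> 'a set"
  assumes q: "q \<ge> 2" and r: "r > 0" and kappa: "\<kappa> * (q - 1) = q * (q * r) - 1"
    and e_sym: "\<And>i j. i \<in> {1..m} \<Longrightarrow> j \<in> {1..m} \<Longrightarrow> e i j = e j i"
    and e_bij: "\<And>i. i \<in> {1..m} \<Longrightarrow> bij_betw (e i) {j \<in> {1..m}. e i j \<noteq> 0} {1..\<kappa>}"
    and e_diag: "\<And>i. i \<in> {1..m} \<Longrightarrow> e i i \<noteq> 0"
    and e_common: "\<And>i i'. i \<in> {1..m} \<Longrightarrow> i' \<in> {1..m} \<Longrightarrow> i \<noteq> i' \<Longrightarrow>
           card {j \<in> {1..m}. e i j \<noteq> 0 \<and> e i' j \<noteq> 0} = l"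
    and affine: "\<And>i. i \<in> {1..m} \<Longrightarrow> affine_design q r (P i) (B i)"
    and disj: "disjoint_family_on P {1..m}"
    and C: "\<And>i. i \<in> {1..m} \<Longrightarrow> bij_betw (C i) {1..\<kappa>} (parallel_classes (B i))"
    and sigma: "\<And>i j. i \<in> {1..m} \<Longrightarrow> j \<in> {1..m} \<Longrightarrow> e i j \<noteq> 0 \<Longrightarrow>
           bij_betw (\<sigma> i j) (C i (e i j)) (C j (e j i))"
    and sigma_inv: "\<And>i j b. i \<in> {1..m} \<Longrightarrow> j \<in> {1..m} \<Longrightarrow> e i j \<noteq> 0 \<Longrightarrow>
           b \<in> C i (e i j) \<Longrightarrow> \<sigma> j i (\<sigma> i j b) = b"
    and sigma_id: "\<And>i b. i \<in> {1..m} \<Longrightarrow> b \<in> C i (e i i) \<Longrightarrow> \<sigma> i i b = b"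
begin

text \<open>With \<open>\<kappa> \<le> 1\<close> the equation \<open>kappa\<close> would give
  \<open>q * (q * r) \<le> q\<close>, although the left side is at least \<open>2 * q\<close>. Two
  parallel classes are what the counts of block and point sizes rest on.\<close>

lemma kappa_ge: "\<kappa> \<ge> 2"
proof (rule ccontr)
  assume "\<not> \<kappa> \<ge> 2"
  then have "\<kappa> * (q - 1) \<le> 1 * (q - 1)" by (intro mult_right_mono) auto
  moreover have "q * 1 \<le> q * r" "2 * (q * r) \<le> q * (q * r)"
    using q r by (auto intro: mult_le_mono)
  ultimately show False using kappa q by linarith
qed

lemma e_range:
  assumes "i \<in> {1..m}" "j \<in> {1..m}" "e i j \<noteq> 0"
  shows "e i j \<in> {1..\<kappa>}"
  using bij_betwE[OF e_bij[OF assms(1)]] assms by blast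

lemma C_mem: "i \<in> {1..m} \<Longrightarrow> a \<in> {1..\<kappa>} \<Longrightarrow> C i a \<in> parallel_classes (B i)"
  using C bij_betwE by blast

lemma C_neq: "i \<in> {1..m} \<Longrightarrow> a \<in> {1..\<kappa>} \<Longrightarrow> b \<in> {1..\<kappa>} \<Longrightarrow> a \<noteq> b \<Longrightarrow> C i a \<noteq> C i b"
  using C[THEN bij_betw_imp_inj_on] by (meson inj_onD)

lemma C_two:
  assumes "i \<in> {1..m}"
  shows "C i 1 \<in> parallel_classes (B i)" "C i 2 \<in> parallel_classes (B i)" "C i 1 \<noteq> C i 2"
  using C_mem[OF assms] C_neq[OF assms, of 1 2] kappa_ge by auto

lemma partition_C: "i \<in> {1..m} \<Longrightarrow> a \<in> {1..\<kappa>} \<Longrightarrow> partition_on (P i) (C i a)"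
  using parallel_classes_partition(1)[OF affine C_mem] .

lemma card_C_block:
  assumes "i \<in> {1..m}" "a \<in> {1..\<kappa>}" "b \<in> C i a"
  shows "card b = q * r"
  \<comment> \<open>At least one of the classes \<open>C i 1\<close> and \<open>C i 2\<close>
    differs from \<open>C i a\<close> and can cut \<open>b\<close> into pieces.\<close>
  using card_block[OF affine[OF assms(1)] C_two(1) C_mem]
    card_block[OF affine[OF assms(1)] C_two(2) C_mem] C_two(3) assms by metis

lemma card_P: "i \<in> {1..m} \<Longrightarrow> card (P i) = q * (q * r)"
  using card_points[OF affine C_two] .

lemma finite_P: "i \<in> {1..m} \<Longrightarrow> finite (P i)"
  using affine by (auto simp: affine_design_def two_design_def)

lemma index_unique: "i \<in> {1..m} \<Longrightarrow> j \<in> {1..m} \<Longrightarrow> x \<in> P i \<Longrightarrow> x \<in> P j \<Longrightarrow> i = j"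
  using disj unfolding disjoint_family_on_def by blast

text \<open>The points of \<open>P j\<close> not adjacent to \<open>x \<in> P i\<close> in \<open>PC(\<Gamma>)\<close>.\<close>

definition missed :: "nat \<Rightarrow> nat \<Rightarrow> 'a \<Rightarrow> 'a set" where
  "missed i j x = (if e i j = 0 then {} else \<sigma> i j (block_through (C i (e i j)) x))"

section \<open>Size and symmetry of the missed blocks\<close>

lemma block_through_C:
  assumes "i \<in> {1..m}" "j \<in> {1..m}" "e i j \<noteq> 0" "x \<in> P i"
  shows "block_through (C i (e i j)) x \<in> C i (e i j)" "x \<in> block_through (C i (e i j)) x"
  using block_through_props[OF partition_C[OF assms(1) e_range[OF assms(1-3)]] assms(4)] by auto

lemma missed_mem:
  assumes "i \<in> {1..m}" "j \<in> {1..m}" "e i j \<noteq> 0" "x \<in> P i"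
  shows "missed i j x \<in> C j (e j i)"
  using block_through_C[OF assms] bij_betwE[OF sigma[OF assms(1-3)]] assms(3)
  by (auto simp: missed_def)

lemma missed_subset:
  assumes "i \<in> {1..m}" "j \<in> {1..m}" "x \<in> P i"
  shows "missed i j x \<subseteq> P j"
proof (cases "e i j = 0")
  case False
  then have "e j i \<noteq> 0" using e_sym[OF assms(1,2)] by simp
  then show ?thesis
    using missed_mem[OF assms(1,2) False assms(3)] partition_C[OF assms(2) e_range[OF assms(2,1)]]
    by (auto simp: partition_on_def)
qed (simp add: missed_def)

lemma card_missed:
  assumes "i \<in> {1..m}" "j \<in> {1..m}" "x \<in> P i"
  shows "card (missed i j x) = q * r * of_bool (e i j \<noteq> 0)"
proof (cases "e i j = 0")
  case False
  then have "e j i \<noteq> 0" using e_sym[OF assms(1,2)] by simp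
  then show ?thesis
    using card_C_block[OF assms(2) e_range[OF assms(2,1)] missed_mem[OF assms(1,2) False assms(3)]]
      False by simp
qed (simp add: missed_def)

text \<open>Since \<open>\<sigma> i i\<close> is the identity, the missed block is the block through
  \<open>x\<close> itself. This is the source of loop-freeness.\<close>

lemma missed_self: "i \<in> {1..m} \<Longrightarrow> x \<in> P i \<Longrightarrow> x \<in> missed i i x"
  using block_through_C[of i i x] e_diag sigma_id by (simp add: missed_def)

text \<open>The block of \<open>y\<close> in the class \<open>C j (e j i)\<close> is
  \<open>missed i j x\<close>, and \<open>\<sigma> j i\<close> carries it back to the block of
  \<open>x\<close>. This makes the graph undirected.\<close>

lemma missed_sym_imp:
  assumes "i \<in> {1..m}" "j \<in> {1..m}" "x \<in> P i" "y \<in> missed i j x"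
  shows "x \<in> missed j i y"
proof -
  have e: "e i j \<noteq> 0" "e j i \<noteq> 0"
    using assms e_sym[OF assms(1,2)] by (auto simp: missed_def split: if_splits)
  have "block_through (C j (e j i)) y = missed i j x"
    using block_through_eq[OF partition_C[OF assms(2) e_range[OF assms(2,1) e(2)]]
        missed_mem[OF assms(1,2) e(1) assms(3)] assms(4)] .
  then have "missed j i y = block_through (C i (e i j)) x"
    using e sigma_inv[OF assms(1,2) e(1) block_through_C(1)[OF assms(1,2) e(1) assms(3)]]
    by (simp add: missed_def)
  then show ?thesis using block_through_C(2)[OF assms(1,2) e(1) assms(3)] by simp
qed

section \<open>Intersections of missed blocks\<close>

lemma card_nonzero: "i \<in> {1..m} \<Longrightarrow> card {j \<in> {1..m}. e i j \<noteq> 0} = \<kappa>"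
  using bij_betw_same_card[OF e_bij] by simp

lemma sum_nonzero: "i \<in> {1..m} \<Longrightarrow> (\<Sum>j\<in>{1..m}. of_bool (e i j \<noteq> 0)) = int \<kappa>"
  using card_nonzero by (simp add: sum.If_cases of_bool_def Int_def)

text \<open>The double count gives \<open>(q - 1) * ?L = q * r - 1\<close>; subtracting this from
  \<open>\<kappa> * (q - 1) = q * (q * r) - 1\<close> leaves \<open>(q - 1) * (q * r)\<close>. The
  additive form avoids truncated subtraction.\<close>

lemma card_joining_classes:
  assumes i: "i \<in> {1..m}" and x: "x \<in> P i" and y: "y \<in> P i" "x \<noteq> y"
  shows "card {F \<in> parallel_classes (B i). block_through F x = block_through F y} + q * r = \<kappa>"
proof -
  let ?L = "card {F \<in> parallel_classes (B i). block_through F x = block_through F y}"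
  have "card (parallel_classes (B i)) = \<kappa>" using bij_betw_same_card[OF C[OF i]] by simp
  then have "(\<kappa> * (q - 1)) * ?L = \<kappa> * (q * r - 1)"
    using card_classes_joining[OF affine[OF i] C_two[OF i] x y] kappa by simp
  \<comment> \<open>Cancels the common positive factor \<open>\<kappa>\<close>.\<close>
  then have "(q - 1) * ?L = q * r - 1" using kappa_ge by (simp add: mult.assoc)
  moreover have "(q - 1) * (q * r) = q * (q * r) - q * r" by (simp add: diff_mult_distrib)
  moreover have "q * r \<ge> 1" "q * r \<le> q * (q * r)" using q r by auto
  ultimately have "(q - 1) * (?L + q * r) = (q - 1) * \<kappa>"
    using kappa by (simp add: distrib_left mult.commute[of _ \<kappa>])
  then show ?thesis using q by simp
qed

lemma sum_card_missed_Int_same: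
  assumes i: "i \<in> {1..m}" and x: "x \<in> P i" and y: "y \<in> P i" "x \<noteq> y"
  shows "(\<Sum>j\<in>{1..m}. int (card (missed i j x \<inter> missed i j y))) = int (q * r) * (int \<kappa> - int (q * r))"
proof -
  let ?J = "{j \<in> {1..m}. e i j \<noteq> 0}"
  let ?S = "\<lambda>F. block_through F x = block_through F y"
  have "int (card (missed i j x \<inter> missed i j y))
          = (if e i j \<noteq> 0 \<and> ?S (C i (e i j)) then int (q * r) else 0)" if j: "j \<in> {1..m}" for j
  proof (cases "e i j = 0")
    case False
    show ?thesis
    proof (cases "?S (C i (e i j))")
      case True
      then have "missed i j x = missed i j y" by (simp add: missed_def)
      then show ?thesis using True False card_missed[OF i j x] by simp
    next
      case neq: False
      \<comment> \<open>Injectivity of \<open>\<sigma> i j\<close> keeps distinct blocks distinct;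
        lying in one parallel class of the \<open>j\<close>-th design, they are then
        disjoint.\<close>
      then have "missed i j x \<noteq> missed i j y"
        using False block_through_C(1)[OF i j False] x y
          bij_betw_imp_inj_on[OF sigma[OF i j False]] by (auto simp: missed_def dest: inj_onD)
      moreover have "e j i \<noteq> 0" using e_sym[OF i j] False by simp
      ultimately have "missed i j x \<inter> missed i j y = {}"
        using missed_mem[OF i j False] x y partition_C[OF j e_range[OF j i]]
        by (auto simp: partition_on_def dest: disjointD)
      then show ?thesis using neq by simp
    qed
  qed (simp add: missed_def)
  then have "(\<Sum>j\<in>{1..m}. int (card (missed i j x \<inter> missed i j y)))
      = (\<Sum>j\<in>{1..m}. if e i j \<noteq> 0 \<and> ?S (C i (e i j)) then int (q * r) else 0)"
    by simp
  also have "\<dots> = int (card {j \<in> {1..m}. e i j \<noteq> 0 \<and> ?S (C i (e i j))}) * int (q * r)"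
    by (simp add: sum.If_cases Int_def)
  \<comment> \<open>Row \<open>i\<close> of \<open>e\<close> followed by \<open>C i\<close> runs
    through every parallel class once, so counting indices becomes counting classes.\<close>
  also have "card {j \<in> {1..m}. e i j \<noteq> 0 \<and> ?S (C i (e i j))}
               = card {F \<in> parallel_classes (B i). ?S F}"
  proof -
    have "bij_betw (C i \<circ> e i) ?J (parallel_classes (B i))"
      using bij_betw_trans[OF e_bij C] i by blast
    note bij = bij_betw_Collect_comp[OF this, of ?S]
    have "{j \<in> ?J. ?S ((C i \<circ> e i) j)} = {j \<in> {1..m}. e i j \<noteq> 0 \<and> ?S (C i (e i j))}"
      by auto
    then show ?thesis using bij_betw_same_card[OF bij] by simp
  qed
  also have "int (card {F \<in> parallel_classes (B i). ?S F}) = int \<kappa> - int (q * r)"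
    using card_joining_classes[OF assms] by linarith
  finally show ?thesis by (simp add: mult.commute)
qed

lemma sum_card_missed_Int_diff:
  assumes i: "i \<in> {1..m}" and i': "i' \<in> {1..m}" "i \<noteq> i'" and x: "x \<in> P i" and y: "y \<in> P i'"
  shows "(\<Sum>j\<in>{1..m}. int (card (missed i j x \<inter> missed i' j y))) = int r * int l"
proof -
  have "int (card (missed i j x \<inter> missed i' j y))
          = (if e i j \<noteq> 0 \<and> e i' j \<noteq> 0 then int r else 0)" if j: "j \<in> {1..m}" for j
  proof (cases "e i j \<noteq> 0 \<and> e i' j \<noteq> 0")
    case True
    then have ji: "e j i \<noteq> 0" "e j i' \<noteq> 0" using e_sym i i' j by auto
    \<comment> \<open>The missed blocks lie in \<open>C j (e j i)\<close> and
      \<open>C j (e j i')\<close>, so injectivity is needed along row \<open>j\<close>; symmetry of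
      \<open>e\<close> moves the nonzero entries there.\<close>
    then have "e j i \<noteq> e j i'"
      using bij_betw_imp_inj_on[OF e_bij[OF j]] i i' by (auto dest: inj_onD)
    then have "card (missed i j x \<inter> missed i' j y) = r"
      using card_Int_nonparallel[OF affine[OF j] C_mem[OF j] C_mem[OF j] C_neq[OF j]]
        e_range[OF j i ji(1)] e_range[OF j i'(1) ji(2)] missed_mem[OF i j _ x]
        missed_mem[OF i'(1) j _ y] True
      by blast
    with True show ?thesis by simp
  qed (auto simp: missed_def)
  then have "(\<Sum>j\<in>{1..m}. int (card (missed i j x \<inter> missed i' j y)))
      = (\<Sum>j\<in>{1..m}. if e i j \<noteq> 0 \<and> e i' j \<noteq> 0 then int r else 0)" by simp
  also have "\<dots> = int (card {j \<in> {1..m}. e i j \<noteq> 0 \<and> e i' j \<noteq> 0}) * int r"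
    by (simp add: sum.If_cases Int_def)
  finally show ?thesis using e_common[OF i i'] by simp
qed

section \<open>Adjacency in the design graph and in its partial complement\<close>

abbreviation G :: "'a pair_pre_digraph" where
  "G \<equiv> PC_graph m P (design_graph m e P C \<sigma>)"

lemma pverts_G: "pverts G = (\<Union>i\<in>{1..m}. P i)"
  by (simp add: PC_graph_def graph_of_matrix_def design_graph_def)

lemma arcs_design_graph:
  assumes "i \<in> {1..m}" "j \<in> {1..m}" "x \<in> P i" "y \<in> P j"
  shows "(x, y) \<in> parcs (design_graph m e P C \<sigma>) \<longleftrightarrow> e i j \<noteq> 0 \<and> y \<notin> missed i j x"
proof -
  have "(x, y) \<in> parcs (design_graph m e P C \<sigma>) \<longleftrightarrow> x \<noteq> y \<and> e i j \<noteq> 0 \<and> y \<notin> missed i j x"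
    using bex_disjoint_family_iff[OF disj assms,
        of "\<lambda>i j. e i j \<noteq> 0 \<and> y \<notin> \<sigma> i j (block_through (C i (e i j)) x)"]
    by (simp add: design_graph_def missed_def)
  \<comment> \<open>If \<open>x = y\<close>, disjointness gives \<open>i = j\<close>, and
    \<open>missed_self\<close> puts \<open>y\<close> into the missed block.\<close>
  moreover have "x \<noteq> y" if "y \<notin> missed i j x"
    using that missed_self[OF assms(1,3)] index_unique[OF assms(1-3)] assms(4) by blast
  ultimately show ?thesis by blast
qed

text \<open>When \<open>e i j \<noteq> 0\<close>, a point misses only \<open>q * r\<close> of the
  \<open>q * (q * r)\<close> points of \<open>P j\<close>, so each row of the matrix block contains
  a 1.\<close>

lemma zero_block_iff:
  assumes "i \<in> {1..m}" "j \<in> {1..m}"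
  shows "zero_block (adjacency_matrix (design_graph m e P C \<sigma>)) (P i) (P j) \<longleftrightarrow> e i j = 0"
proof -
  have "P i \<noteq> {}" using card_P[OF assms(1)] q r by auto
  then obtain x where x: "x \<in> P i" by blast
  have "card (missed i j x) < card (P j)"
    using card_missed[OF assms x] card_P[OF assms(2)] q r by auto
  then have "missed i j x \<noteq> P j" by auto
  then have "\<exists>y\<in>P j. y \<notin> missed i j x" using missed_subset[OF assms x] by blast
  with x show ?thesis
    using arcs_design_graph[OF assms]
    by (auto simp: zero_block_def adjacency_matrix_def)
qed

text \<open>Off the diagonal, the all-ones blocks replace exactly those with
  \<open>e i j = 0\<close>, where \<open>missed\<close> is empty; \<open>e_diag\<close> rules this
  out on the diagonal. One formula then covers all pairs.\<close>

lemma arcs_G: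
  assumes "i \<in> {1..m}" "j \<in> {1..m}" "x \<in> P i" "y \<in> P j"
  shows "(x, y) \<in> parcs G \<longleftrightarrow> y \<notin> missed i j x"
proof -
  let ?N = "adjacency_matrix (design_graph m e P C \<sigma>)"
  have "(\<exists>i'\<in>{1..m}. \<exists>j'\<in>{1..m}. i' \<noteq> j' \<and> x \<in> P i' \<and> y \<in> P j' \<and> zero_block ?N (P i') (P j'))
          \<longleftrightarrow> i \<noteq> j \<and> zero_block ?N (P i) (P j)"
    using bex_disjoint_family_iff[OF disj assms, of "\<lambda>i j. i \<noteq> j \<and> zero_block ?N (P i) (P j)"]
    by meson
  also have "\<dots> \<longleftrightarrow> e i j = 0" using zero_block_iff[OF assms(1,2)] e_diag[OF assms(1)] by auto
  finally have PC: "PC_matrix m P ?N x y = (if e i j = 0 then 1 else ?N x y)"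
    by (simp only: PC_matrix_def)
  have "x \<in> pverts G" "y \<in> pverts G" using assms unfolding pverts_G by blast+
  then have "(x, y) \<in> parcs G \<longleftrightarrow> PC_matrix m P ?N x y = 1"
    by (simp add: PC_graph_def graph_of_matrix_def)
  then have "(x, y) \<in> parcs G \<longleftrightarrow> e i j = 0 \<or> e i j \<noteq> 0 \<and> y \<notin> missed i j x"
    using arcs_design_graph[OF assms] by (simp add: PC adjacency_matrix_def)
  then show ?thesis by (auto simp: missed_def)
qed

lemma arcs_G_verts: "(x, y) \<in> parcs G \<Longrightarrow> x \<in> pverts G \<and> y \<in> pverts G"
  by (auto simp: PC_graph_def graph_of_matrix_def)

lemma pair_graph_G: "pair_graph G"
proof
  show fin: "finite (pverts G)" using finite_P by (simp add: pverts_G)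
  show "fst a \<in> pverts G" "snd a \<in> pverts G" if "a \<in> parcs G" for a
    using that arcs_G_verts by (metis prod.collapse)+
  have "parcs G \<subseteq> pverts G \<times> pverts G" using arcs_G_verts by auto
  then show "finite (parcs G)" using fin finite_subset by blast
  show "fst a \<noteq> snd a" if "a \<in> parcs G" for a
  proof
    assume eq: "fst a = snd a"
    have "fst a \<in> pverts G" using that arcs_G_verts by (metis prod.collapse)
    then obtain i where "i \<in> {1..m}" "fst a \<in> P i" by (auto simp: pverts_G)
    then show False using that arcs_G missed_self eq by (metis prod.collapse)
  qed
  show "symmetric G"
  proof -
    have "(y, x) \<in> parcs G" if xy: "(x, y) \<in> parcs G" for x y
    proof -
      obtain i j where ij: "i \<in> {1..m}" "j \<in> {1..m}" "x \<in> P i" "y \<in> P j"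
        using arcs_G_verts[OF xy] by (auto simp: pverts_G)
      then show ?thesis using arcs_G xy missed_sym_imp by metis
    qed
    then show ?thesis by (auto simp: symmetric_def intro!: symI)
  qed
qed

section \<open>Counting vertices, neighbours and common neighbours\<close>

lemma card_UN_P:
  assumes "\<And>j. j \<in> {1..m} \<Longrightarrow> S j \<subseteq> P j"
  shows "card (\<Union>j\<in>{1..m}. S j) = (\<Sum>j\<in>{1..m}. card (S j))"
proof (rule card_UN_disjoint)
  show "\<forall>j\<in>{1..m}. finite (S j)" using assms finite_P finite_subset by blast
  show "\<forall>i\<in>{1..m}. \<forall>j\<in>{1..m}. i \<noteq> j \<longrightarrow> S i \<inter> S j = {}"
    using assms index_unique by blast
qed simp

lemma card_verts: "card (pverts G) = q * (q * r) * m"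
  using card_UN_P[of P] card_P by (simp add: pverts_G)

text \<open>Each of the \<open>\<kappa>\<close> nonzero entries in row \<open>i\<close> costs one
  block. The count is made in \<open>int\<close>, where subtraction is exact.\<close>

lemma degree_G:
  assumes i: "i \<in> {1..m}" and x: "x \<in> P i"
  shows "int (out_degree (with_proj G) x) = int m * int (q * (q * r)) - int (q * r) * int \<kappa>"
proof -
  have "out_arcs (with_proj G) x = Pair x ` (\<Union>j\<in>{1..m}. P j - missed i j x)"
  proof -
    have "(x, y) \<in> parcs G \<longleftrightarrow> y \<in> (\<Union>j\<in>{1..m}. P j - missed i j x)" for y
      using arcs_G[OF i _ x] arcs_G_verts[of x y] unfolding pverts_G by blast
    then show ?thesis by (auto simp: out_arcs_def)
  qed
  then have "out_degree (with_proj G) x = card (\<Union>j\<in>{1..m}. P j - missed i j x)"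
    by (simp add: out_degree_def card_image inj_on_def)
  also have "\<dots> = (\<Sum>j\<in>{1..m}. card (P j - missed i j x))" by (rule card_UN_P) auto
  finally have "int (out_degree (with_proj G) x) = (\<Sum>j\<in>{1..m}. int (card (P j - missed i j x)))"
    by simp
  also have "\<dots> = (\<Sum>j\<in>{1..m}. int (q * (q * r)) - int (q * r) * of_bool (e i j \<noteq> 0))"
  proof (rule sum.cong)
    fix j assume j: "j \<in> {1..m}"
    have "int (card (P j - missed i j x)) = int (card (P j)) - int (card (missed i j x))"
      using missed_subset[OF i j x] finite_P[OF j]
      by (simp add: card_Diff_subset finite_subset card_mono of_nat_diff)
    then show "int (card (P j - missed i j x))
        = int (q * (q * r)) - int (q * r) * of_bool (e i j \<noteq> 0)"
      using card_P[OF j] card_missed[OF i j x] by simp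
  qed simp
  also have "\<dots> = int m * int (q * (q * r)) - int (q * r) * int \<kappa>"
    using sum_nonzero[OF i] by (simp only: sum_subtractf sum_distrib_left[symmetric]) simp
  finally show ?thesis .
qed

text \<open>Valid for \<open>i = i'\<close> and \<open>i \<noteq> i'\<close> alike, so the two
  values of the design graph differ only in the final sum.\<close>

lemma card_common_neighbours:
  assumes i: "i \<in> {1..m}" and i': "i' \<in> {1..m}" and x: "x \<in> P i" and y: "y \<in> P i'"
  shows "int (card (common_neighbours G x y)) = int m * int (q * (q * r)) - 2 * int (q * r) * int \<kappa>
           + (\<Sum>j\<in>{1..m}. int (card (missed i j x \<inter> missed i' j y)))"
proof -
  have "common_neighbours G x y = (\<Union>j\<in>{1..m}. P j - (missed i j x \<union> missed i' j y))"
    using arcs_G[OF i _ x] arcs_G[OF i' _ y] by (auto simp: common_neighbours_def pverts_G)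
  then have "card (common_neighbours G x y)
      = (\<Sum>j\<in>{1..m}. card (P j - (missed i j x \<union> missed i' j y)))"
    by (simp only:) (rule card_UN_P, auto)
  then have "int (card (common_neighbours G x y))
      = (\<Sum>j\<in>{1..m}. int (card (P j - (missed i j x \<union> missed i' j y))))"
    by simp
  also have "\<dots> = (\<Sum>j\<in>{1..m}. int (q * (q * r)) - int (q * r) * of_bool (e i j \<noteq> 0)
      - int (q * r) * of_bool (e i' j \<noteq> 0) + int (card (missed i j x \<inter> missed i' j y)))"
  proof (rule sum.cong)
    fix j assume j: "j \<in> {1..m}"
    let ?a = "missed i j x" and ?b = "missed i' j y"
    have sub: "?a \<subseteq> P j" "?b \<subseteq> P j" using missed_subset i i' j x y by auto
    then have fin: "finite ?a" "finite ?b" using finite_P[OF j] finite_subset by auto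
    have "int (card (P j - (?a \<union> ?b))) = int (card (P j)) - int (card (?a \<union> ?b))"
      using sub fin finite_P[OF j]
      by (simp add: card_Diff_subset card_mono of_nat_diff)
    moreover have "int (card ?a) + int (card ?b) = int (card (?a \<union> ?b)) + int (card (?a \<inter> ?b))"
      using card_Un_Int[OF fin] by linarith
    ultimately show "int (card (P j - (?a \<union> ?b))) = int (q * (q * r))
        - int (q * r) * of_bool (e i j \<noteq> 0) - int (q * r) * of_bool (e i' j \<noteq> 0)
        + int (card (?a \<inter> ?b))"
      using card_P[OF j] card_missed[OF i j x] card_missed[OF i' j y] by simp
  qed simp
  also have "\<dots> = int m * int (q * (q * r)) - 2 * int (q * r) * int \<kappa>
      + (\<Sum>j\<in>{1..m}. int (card (missed i j x \<inter> missed i' j y)))"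
    using sum_nonzero[OF i] sum_nonzero[OF i']
    by (simp only: sum.distrib sum_subtractf sum_distrib_left[symmetric]) simp
  finally show ?thesis .
qed

lemma kappa_le: "i \<in> {1..m} \<Longrightarrow> \<kappa> \<le> m"
  using card_nonzero[of i] card_mono[of "{1..m}" "{j \<in> {1..m}. e i j \<noteq> 0}"] by fastforce

text \<open>Bounds from the intersection and the union of two row supports. They make the
  natural-number differences \<open>\<kappa> - l\<close> and \<open>m + l - 2 * \<kappa>\<close>
  exact; the latter counts the indices outside both supports.\<close>

lemma l_bounds:
  assumes "i \<in> {1..m}" "i' \<in> {1..m}" "i \<noteq> i'"
  shows "l \<le> \<kappa>" "2 * \<kappa> \<le> m + l"
proof -
  let ?S = "{j \<in> {1..m}. e i j \<noteq> 0}" and ?T = "{j \<in> {1..m}. e i' j \<noteq> 0}"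
  have Int: "?S \<inter> ?T = {j \<in> {1..m}. e i j \<noteq> 0 \<and> e i' j \<noteq> 0}" by auto
  have "card (?S \<inter> ?T) \<le> card ?S" by (intro card_mono) auto
  then show "l \<le> \<kappa>" using card_nonzero[OF assms(1)] e_common[OF assms] Int by simp
  have "card ?S + card ?T = card (?S \<union> ?T) + card (?S \<inter> ?T)" by (intro card_Un_Int) auto
  moreover have "card (?S \<union> ?T) \<le> card {1..m}" by (intro card_mono) auto
  ultimately show "2 * \<kappa> \<le> m + l"
    using card_nonzero[OF assms(1)] card_nonzero[OF assms(2)] e_common[OF assms] Int by simp
qed

lemma kappa_int: "int \<kappa> * (int q - 1) = int q * (int q * int r) - 1"
proof -
  have "int (\<kappa> * (q - 1)) = int (q * (q * r) - 1)" using kappa by simp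
  then show ?thesis using q r by (simp add: of_nat_diff Suc_leI)
qed

lemma divisible_design_graph_G:
  "divisible_design_graph G (q * (q * r) * m)
     (q * r * (q * (q * r) - 1) + q * (q * r) * (m - \<kappa>))
     (q * r * (q * (q * r) - q * r - 1) + q * (q * r) * (m - \<kappa>))
     (r * (q - 1)\<^sup>2 * l + 2 * (q * (q * r) - q * r) * (\<kappa> - l) + q * (q * r) * (m + l - 2 * \<kappa>))
     m (q * (q * r))"
proof -
  have qr: "2 * (q * r) \<le> q * (q * r)" "1 \<le> q * r" using q r by auto
  have qr_diff: "int (q * (q * r) - Suc (q * r)) = int q * (int q * int r) - int q * int r - 1"
  proof -
    have "int (q * (q * r) - Suc (q * r)) = int (q * (q * r)) - int (Suc (q * r))"
      using qr by (intro of_nat_diff) linarith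
    then show ?thesis by simp
  qed
  have k: "out_degree (with_proj G) x = q * r * (q * (q * r) - 1) + q * (q * r) * (m - \<kappa>)"
    if i: "i \<in> {1..m}" and x: "x \<in> P i" for i x
  proof -
    have "int (out_degree (with_proj G) x)
            = int (q * r * (q * (q * r) - 1) + q * (q * r) * (m - \<kappa>))"
      \<comment> \<open>The two expressions differ by a multiple of \<open>kappa_int\<close> with
        factor \<open>q * r\<close>; the same holds for the count within a class below.\<close>
      unfolding degree_G[OF i x] using kappa_le[OF i] qr kappa_int
      by (simp add: of_nat_diff) algebra
    then show ?thesis by linarith
  qed
  have l1: "card (common_neighbours G x y)
      = q * r * (q * (q * r) - q * r - 1) + q * (q * r) * (m - \<kappa>)"
    if i: "i \<in> {1..m}" and xy: "x \<in> P i" "y \<in> P i" "x \<noteq> y" for i x y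
  proof -
    have "int (card (common_neighbours G x y))
        = int (q * r * (q * (q * r) - q * r - 1) + q * (q * r) * (m - \<kappa>))"
      unfolding card_common_neighbours[OF i i xy(1,2)] sum_card_missed_Int_same[OF i xy]
      using kappa_le[OF i] qr_diff kappa_int
      by (simp add: of_nat_diff) algebra
    then show ?thesis by linarith
  qed
  have l2: "card (common_neighbours G x y)
      = r * (q - 1)\<^sup>2 * l + 2 * (q * (q * r) - q * r) * (\<kappa> - l) + q * (q * r) * (m + l - 2 * \<kappa>)"
    if i: "i \<in> {1..m}" "i' \<in> {1..m}" "i \<noteq> i'" and xy: "x \<in> P i" "y \<in> P i'" for i i' x y
  proof -
    have "int (card (common_neighbours G x y)) = int (r * (q - 1)\<^sup>2 * l
        + 2 * (q * (q * r) - q * r) * (\<kappa> - l) + q * (q * r) * (m + l - 2 * \<kappa>))"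
      \<comment> \<open>A polynomial identity. The three target summands sort the indices
        \<open>j\<close> by whether both, exactly one or neither of \<open>e i j\<close> and
        \<open>e i' j\<close> is nonzero; two blocks meeting in \<open>r\<close> points leave
        \<open>r * (q - 1)\<^sup>2\<close> points uncovered.\<close>
      unfolding card_common_neighbours[OF i(1,2) xy] sum_card_missed_Int_diff[OF i xy]
      using l_bounds[OF i] qr q
      by (simp add: of_nat_diff) algebra
    then show ?thesis by linarith
  qed
  have nonempty: "P i \<noteq> {}" if "i \<in> {1..m}" for i using card_P[OF that] q r by auto
  \<comment> \<open>Nonempty disjoint sets are distinct, so the image of \<open>P\<close> really has
    \<open>m\<close> classes.\<close>
  have inj: "inj_on P {1..m}" using nonempty index_unique by (fastforce intro: inj_onI)
  have "partition_on (pverts G) (P ` {1..m})"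
    using nonempty index_unique
    by (auto simp: partition_on_def pverts_G disjoint_def) blast+
  moreover have "card (P ` {1..m}) = m" using inj by (simp add: card_image)
  moreover have "\<forall>c\<in>P ` {1..m}. card c = q * (q * r)" using card_P by auto
  moreover have "regular_graph G (q * r * (q * (q * r) - 1) + q * (q * r) * (m - \<kappa>))"
    using k by (auto simp: regular_graph_def pverts_G)
  ultimately show ?thesis
    unfolding divisible_design_graph_def using pair_graph_G card_verts l1 l2
    by (intro conjI exI[of _ "P ` {1..m}"]) blast+
qed

end

section \<open>Deriving the abstract setting from the symmetric design and its matrices\<close>

theorem theorem2:
  fixes q d m \<kappa> l :: nat
    and X :: "'p set" and Y :: "'b set" and inc :: "'p \<Rightarrow> 'b \<Rightarrow> bool"
    and A :: "nat \<Rightarrow> nat \<Rightarrow> int" and e :: "nat \<Rightarrow> nat \<Rightarrow> nat"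
    and P :: "nat \<Rightarrow> 'a set" and B :: "nat \<Rightarrow> 'a set set" and C :: "nat \<Rightarrow> nat \<Rightarrow> 'a set set"
    and \<sigma> :: "nat \<Rightarrow> nat \<Rightarrow> 'a set \<Rightarrow> 'a set" and \<Gamma> :: "'a pair_pre_digraph"
  assumes "q \<ge> 2" and "d \<ge> 2" and "\<kappa> = (q ^ d - 1) div (q - 1)"
    and "symmetric_design X Y inc m \<kappa> l"
    and "is_incidence_matrix X Y inc m A"
    and "symmetric_matrix m A"
    and "symmetric_matrix m e"
    and "\<And>i j. i \<in> {1..m} \<Longrightarrow> j \<in> {1..m} \<Longrightarrow> e i j = 0 \<longleftrightarrow> A i j = 0"
    and "\<And>i. i \<in> {1..m} \<Longrightarrow> bij_betw (e i) {j \<in> {1..m}. A i j \<noteq> 0} {1..\<kappa>}"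
    and "\<And>i. i \<in> {1..m} \<Longrightarrow> affine_design q (q ^ (d - 2)) (P i) (B i)"
    and "disjoint_family_on P {1..m}"
    and "\<And>i. i \<in> {1..m} \<Longrightarrow> bij_betw (C i) {1..\<kappa>} (parallel_classes (B i))"
    and "\<And>i j. i \<in> {1..m} \<Longrightarrow> j \<in> {1..m} \<Longrightarrow> e i j \<noteq> 0 \<Longrightarrow>
           bij_betw (\<sigma> i j) (C i (e i j)) (C j (e j i))"
    and "\<And>i j b. i \<in> {1..m} \<Longrightarrow> j \<in> {1..m} \<Longrightarrow> i \<noteq> j \<Longrightarrow> e i j \<noteq> 0 \<Longrightarrow>
           b \<in> C i (e i j) \<Longrightarrow> \<sigma> j i (\<sigma> i j b) = b"
    and "\<And>i b. i \<in> {1..m} \<Longrightarrow> e i i \<noteq> 0 \<Longrightarrow> b \<in> C i (e i i) \<Longrightarrow> \<sigma> i i b = b"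
    and "\<Gamma> = design_graph m e P C \<sigma>"
    and "\<And>i. i \<in> {1..m} \<Longrightarrow> \<not> zero_block (adjacency_matrix \<Gamma>) (P i) (P i)"
  shows "divisible_design_graph (PC_graph m P \<Gamma>)
           (q ^ d * m)
           (q ^ (d - 1) * (q ^ d - 1) + q ^ d * (m - \<kappa>))
           (q ^ (d - 1) * (q ^ d - q ^ (d - 1) - 1) + q ^ d * (m - \<kappa>))
           (q ^ (d - 2) * (q - 1)\<^sup>2 * l + 2 * (q ^ d - q ^ (d - 1)) * (\<kappa> - l)
              + q ^ d * (m + l - 2 * \<kappa>))
           m (q ^ d)"
proof -
  note A_e = assms(8) and sigma_inv = assms(14) and sigma_id = assms(15)
  obtain d' where d': "d = Suc (Suc d')"
    using assms(2) by (metis add_2_eq_Suc le_Suc_ex)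
  have pow: "q ^ d = q * (q * q ^ (d - 2))" "q ^ (d - 1) = q * q ^ (d - 2)"
    by (simp_all add: d')
  have e_nonzero: "{j \<in> {1..m}. A i j \<noteq> 0} = {j \<in> {1..m}. e i j \<noteq> 0}" if "i \<in> {1..m}" for i
    by (intro Collect_cong conj_cong refl) (simp only: A_e[OF that])
  \<comment> \<open>Makes the \<open>div\<close> in the definition of \<open>\<kappa>\<close>
    exact.\<close>
  have "(q - 1) dvd (q ^ d - 1)"
  proof -
    have "int q - 1 dvd int q ^ d - 1" by (simp add: power_diff_1_eq)
    then have "int (q - 1) dvd int (q ^ d - 1)" using assms(1) by (simp add: of_nat_diff)
    then show ?thesis by (simp only: of_nat_dvd_iff)
  qed
  then have kappa: "\<kappa> * (q - 1) = q * (q * q ^ (d - 2)) - 1"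
    using assms(3) pow by simp
  obtain pt bl where pt: "bij_betw pt {1..m} X" and bl: "bij_betw bl {1..m} Y"
    and A: "\<And>i j. i \<in> {1..m} \<Longrightarrow> j \<in> {1..m} \<Longrightarrow> A i j = (if inc (pt i) (bl j) then 1 else 0)"
    using assms(5) by (auto simp: is_incidence_matrix_def)
  have common: "card {j \<in> {1..m}. e i j \<noteq> 0 \<and> e i' j \<noteq> 0} = l"
    if i: "i \<in> {1..m}" and i': "i' \<in> {1..m}" "i \<noteq> i'" for i i'
  proof -
    have "{j \<in> {1..m}. e i j \<noteq> 0 \<and> e i' j \<noteq> 0}
            = {j \<in> {1..m}. inc (pt i) (bl j) \<and> inc (pt i') (bl j)}"
    proof -
      have "e i j \<noteq> 0 \<longleftrightarrow> inc (pt i) (bl j)" if "i \<in> {1..m}" "j \<in> {1..m}" for i j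
        using A_e[OF that] A[OF that] by simp
      then show ?thesis using i i'(1) by blast
    qed
    \<comment> \<open>The column enumeration turns common nonzero columns into common blocks of two
      points, which are distinct because \<open>pt\<close> is injective.\<close>
    moreover have bij: "bij_betw bl {j \<in> {1..m}. inc (pt i) (bl j) \<and> inc (pt i') (bl j)}
        {b \<in> Y. inc (pt i) b \<and> inc (pt i') b}"
      by (rule bij_betw_Collect_comp[OF bl])
    moreover have "pt i \<in> X" "pt i' \<in> X" using bij_betwE[OF pt] i i'(1) by blast+
    moreover have "pt i \<noteq> pt i'"
      using inj_on_eq_iff[OF bij_betw_imp_inj_on[OF pt] i i'(1)] i'(2) by blast
    ultimately show ?thesis
      using assms(4) bij_betw_same_card[OF bij]
      by (simp add: symmetric_design_def two_design_def)
  qed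
  \<comment> \<open>With \<open>e i i = 0\<close> there would be no arc inside \<open>P i\<close>,
    and the diagonal block would vanish.\<close>
  have diag: "e i i \<noteq> 0" if i: "i \<in> {1..m}" for i
  proof
    assume e: "e i i = 0"
    have "(x, y) \<notin> parcs \<Gamma>" if "x \<in> P i" "y \<in> P i" for x y
      using bex_disjoint_family_iff[OF assms(11) i i that,
          of "\<lambda>i j. e i j \<noteq> 0 \<and> y \<notin> \<sigma> i j (block_through (C i (e i j)) x)"] e
      by (simp add: assms(16) design_graph_def)
    then show False
      using assms(17)[OF i] by (auto simp: zero_block_def adjacency_matrix_def)
  qed
  interpret partial_complement q "q ^ (d - 2)" \<kappa> l m e P B C \<sigma>
  proof
    \<comment> \<open>The inverse law is given only for \<open>i \<noteq> j\<close>; on the diagonal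
      it follows from \<open>\<sigma> i i\<close> being the identity.\<close>
    show "\<sigma> j i (\<sigma> i j b) = b"
      if "i \<in> {1..m}" "j \<in> {1..m}" "e i j \<noteq> 0" "b \<in> C i (e i j)" for i j b
      using that sigma_inv sigma_id by (cases "i = j") auto
    show "bij_betw (e i) {j \<in> {1..m}. e i j \<noteq> 0} {1..\<kappa>}" if "i \<in> {1..m}" for i
      using assms(9)[OF that] e_nonzero[OF that] by simp
    show "e i j = e j i" if "i \<in> {1..m}" "j \<in> {1..m}" for i j
      using that assms(7) by (simp add: symmetric_matrix_def)
  qed (use assms(1) kappa common diag assms(10-13) sigma_id in auto)
  show ?thesis
    using divisible_design_graph_G unfolding assms(16) pow .
qed

end
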